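(* Let $0<a<b<\infty$, $0<\alpha<1$, $0\le\beta\le 1$, $\gamma=\alpha+\beta-\alpha\beta$, and $u_a\in\mathbb{R}$. Let $\psi\in C^1([a,b],\mathbb{R})$ be increasing with $\psi'(t)\ne 0$ for all $t\in[a,b]$. Let $f:(a,b]\times\mathbb{R}\times\mathbb{R}\to\mathbb{R}$ be such that for all $u,v\in C_{1-\gamma;\psi}[a,b]$ the function $t\mapsto f(t,u(t),v(t))$ belongs to $C_{1-\gamma;\psi}[a,b]$. If $u\in C_{1-\gamma;\psi}^{\gamma}[a,b]$, then $u$ satisfies the Cauchy-type problem $$D_{a^+}^{\alpha,\beta;\psi}u(t)=f\big(t,u(t),D_{a^+}^{\alpha,\beta;\psi}u(t)\big),\quad t\in(a,b],\qquad I_{a^+}^{1-\gamma;\psi}u(a)=u_a,$$ if and only if $u$ satisfies, for $t\in(a,b]$, the Volterra integral equation $$u(t)=\frac{u_a}{\Gamma(\gamma)}(\psi(t)-\psi(a))^{\gamma-1}+\frac{1}{\Gamma(\alpha)}\int_a^t\psi'(s)(\psi(t)-\psi(s))^{\alpha-1}f\big(s,u(s),D_{a^+}^{\alpha,\beta;\psi}u(s)\big)\,ds.$$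
   Context: For $\mu>0$, the $\psi$-Riemann–Liouville fractional integral is $$I_{a^+}^{\mu;\psi}h(t)=\frac{1}{\Gamma(\mu)}\int_a^t\psi'(s)(\psi(t)-\psi(s))^{\mu-1}h(s)\,ds,$$ and $I_{a^+}^{0;\psi}$ is the identity. The value $I_{a^+}^{1-\gamma;\psi}u(a)$ means $\lim_{t\to a^+}I_{a^+}^{1-\gamma;\psi}u(t)$. For $0<\alpha<1$, $0\le\beta\le1$, $\gamma=\alpha+\beta-\alpha\beta$, the $\psi$-Hilfer fractional derivative of order $\alpha$ and type $\beta$ is $$D_{a^+}^{\alpha,\beta;\psi}h(t)=I_{a^+}^{\beta(1-\alpha);\psi}\Big[\tfrac{1}{\psi'(t)}\tfrac{d}{dt}\Big]I_{a^+}^{(1-\beta)(1-\alpha);\psi}h(t)=I_{a^+}^{\gamma-\alpha;\psi}D_{a^+}^{\gamma;\psi}h(t),$$ where $D_{a^+}^{\gamma;\psi}h(t)=\big[\tfrac{1}{\psi'(t)}\tfrac{d}{dt}\big]I_{a^+}^{1-\gamma;\psi}h(t)$ (note $(1-\beta)(1-\alpha)=1-\gamma$ and $\beta(1-\alpha)=\gamma-\alpha$). Weighted spaces: $C_{1-\gamma;\psi}[a,b]=\{h:(a,b]\to\mathbb{R}\;:\;(\psi(t)-\psi(a))^{1-\gamma}h(t)\in C[a,b]\}$ (meaning that the weighted function extends continuously to $[a,b]$), with norm $\|h\|_{C_{1-\gamma;\psi}[a,b]}=\max_{t\in[a,b]}|(\psi(t)-\psi(a))^{1-\gamma}h(t)|$;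 and $C_{1-\gamma;\psi}^{\gamma}[a,b]=\{h\in C_{1-\gamma;\psi}[a,b]\;:\;D_{a^+}^{\gamma;\psi}h\in C_{1-\gamma;\psi}[a,b]\}$. *)

theory Defs
  imports "HOL-Analysis.Analysis"
begin

text \<open>
  Functions on \<open>(a,b]\<close> are total functions of type \<^typ>\<open>real \<Rightarrow> real\<close> whose values outside \<open>(a,b]\<close>
  are never used: the interval integral \<open>LBINT s=a..t\<close> with \<open>a \<le> t\<close> only sees the open interval
  \<open>(a,t)\<close>, and derivatives are taken within \<open>(a,b]\<close>, hence one-sided at \<open>b\<close>.  The argument \<open>\<psi>'\<close>
  stands for the derivative of \<open>\<psi>\<close>.
\<close>

definition psi_RL_integral ::
  "real \<Rightarrow> (real \<Rightarrow> real) \<Rightarrow> (real \<Rightarrow> real) \<Rightarrow> real \<Rightarrow> (real \<Rightarrow> real) \<Rightarrow> real \<Rightarrow> real" where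
  "psi_RL_integral a \<psi> \<psi>' \<mu> h t =
     (if \<mu> = 0 then h t
      else 1 / Gamma \<mu> * (LBINT s=a..t. \<psi>' s * (\<psi> t - \<psi> s) powr (\<mu> - 1) * h s))"

definition psi_deriv ::
  "real \<Rightarrow> real \<Rightarrow> (real \<Rightarrow> real) \<Rightarrow> (real \<Rightarrow> real) \<Rightarrow> real \<Rightarrow> real" where
  "psi_deriv a b \<psi>' h t = 1 / \<psi>' t * vector_derivative h (at t within {a<..b})"

definition psi_RL_deriv ::
  "real \<Rightarrow> real \<Rightarrow> (real \<Rightarrow> real) \<Rightarrow> (real \<Rightarrow> real) \<Rightarrow> real \<Rightarrow> (real \<Rightarrow> real) \<Rightarrow> real \<Rightarrow> real" where
  "psi_RL_deriv a b \<psi> \<psi>' \<gamma> h = psi_deriv a b \<psi>' (psi_RL_integral a \<psi> \<psi>' (1 - \<gamma>) h)"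

definition psi_Hilfer_deriv ::
  "real \<Rightarrow> real \<Rightarrow> (real \<Rightarrow> real) \<Rightarrow> (real \<Rightarrow> real) \<Rightarrow> real \<Rightarrow> real \<Rightarrow> (real \<Rightarrow> real) \<Rightarrow> real \<Rightarrow> real" where
  "psi_Hilfer_deriv a b \<psi> \<psi>' \<alpha> \<beta> h =
     psi_RL_integral a \<psi> \<psi>' (\<beta> * (1 - \<alpha>))
       (psi_deriv a b \<psi>' (psi_RL_integral a \<psi> \<psi>' ((1 - \<beta>) * (1 - \<alpha>)) h))"

text \<open>
  The space with weight exponent \<open>\<delta>\<close>.  The weighted function is only required to agree with a
  continuous function on \<open>(a,b]\<close>, since \<open>h\<close> has no value at \<open>a\<close>.
\<close>

definition psi_weighted_C :: "real \<Rightarrow> real \<Rightarrow> (real \<Rightarrow> real) \<Rightarrow> real \<Rightarrow> (real \<Rightarrow> real) set" where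
  "psi_weighted_C a b \<psi> \<delta> =
     {h. \<exists>g. continuous_on {a..b} g \<and> (\<forall>t\<in>{a<..b}. g t = (\<psi> t - \<psi> a) powr \<delta> * h t)}"

text \<open>
  Differentiability is explicit below because \<^const>\<open>vector_derivative\<close> is total.
\<close>

definition psi_weighted_C_deriv ::
  "real \<Rightarrow> real \<Rightarrow> (real \<Rightarrow> real) \<Rightarrow> (real \<Rightarrow> real) \<Rightarrow> real \<Rightarrow> (real \<Rightarrow> real) set" where
  "psi_weighted_C_deriv a b \<psi> \<psi>' \<gamma> =
     {h \<in> psi_weighted_C a b \<psi> (1 - \<gamma>).
        psi_RL_integral a \<psi> \<psi>' (1 - \<gamma>) h differentiable_on {a<..b} \<and>
        psi_RL_deriv a b \<psi> \<psi>' \<gamma> h \<in> psi_weighted_C a b \<psi> (1 - \<gamma>)}"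

end

theory Submission
  imports Defs
begin

text \<open>
  In the variable \<open>x = \<psi> t - \<psi> a\<close> the operator \<open>I\<^sup>\<mu>\<close> becomes convolution with the
  Riemann--Liouville kernel \<open>k\<^sub>\<mu> x = x\<^bsup>\<mu>-1\<^esup> / \<Gamma> \<mu>\<close>, and the Beta integral says
  \<open>k\<^sub>\<mu> * k\<^sub>\<nu> = k\<^bsub>\<mu>+\<nu>\<^esub>\<close>; by Fubini, \<open>I\<^sup>\<mu> I\<^sup>\<nu> = I\<^bsup>\<mu>+\<nu>\<^esup>\<close> on the weighted space.
  Since \<open>I\<^sup>1\<close> is injective there, so is \<open>I\<^sup>\<mu>\<close> for \<open>0 \<le> \<mu> \<le> 1\<close>.
  With \<open>w = D\<^sup>\<gamma> u\<close>, the initial condition amounts to \<open>I\<^bsup>1-\<gamma>\<^esup> u = u\<^sub>a + I\<^sup>1 w\<close>, and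
  \<open>D\<^bsup>\<alpha>,\<beta>\<^esup> u = I\<^bsup>\<gamma>-\<alpha>\<^esup> w\<close>.  Applying \<open>I\<^bsup>1-\<gamma>\<^esup>\<close> to both sides of the Volterra equation
  with right-hand side \<open>g\<close> gives \<open>I\<^bsup>1-\<gamma>\<^esup> u = u\<^sub>a + I\<^bsup>1-\<gamma>+\<alpha>\<^esup> g\<close>, so both directions follow by
  cancelling \<open>I\<^bsup>1-\<gamma>\<^esup>\<close>, respectively \<open>I\<^bsup>1-\<gamma>+\<alpha>\<^esup>\<close>.
\<close>

section \<open>Riemann--Liouville kernels on the real line and their convolutions\<close>

text \<open>The extension by zero turns integrals over (0,x) into convolutions over the whole line,
  so that Fubini, translation and scaling involve no limits of integration.\<close>

definition rl_kernel :: "real \<Rightarrow> real \<Rightarrow> real" where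
  "rl_kernel \<mu> x = (if 0 < x then x powr (\<mu> - 1) / Gamma \<mu> else 0)"

lemma rl_kernel_measurable [measurable]: "rl_kernel \<mu> \<in> borel_measurable borel"
  unfolding rl_kernel_def [abs_def] by measurable

lemma rl_kernel_nonneg: "0 < \<mu> \<Longrightarrow> 0 \<le> rl_kernel \<mu> x"
  unfolding rl_kernel_def using Gamma_real_pos [of \<mu>] by (auto simp: less_imp_le)

lemma rl_kernel_nonpos_arg: "x \<le> 0 \<Longrightarrow> rl_kernel \<mu> x = 0"
  by (simp add: rl_kernel_def)

lemma rl_kernel_scale:
  assumes "0 < x"
  shows "rl_kernel \<mu> (x * z) = x powr (\<mu> - 1) * rl_kernel \<mu> z"
  using assms by (auto simp: rl_kernel_def powr_mult zero_less_mult_iff)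

text \<open>Scaling by x reduces the claim to x = 1, which is the Beta integral. Working with
  nonnegative integrals yields integrability together with the value.\<close>

lemma nn_integral_rl_kernel_convolution:
  assumes "0 < \<mu>" "0 < \<nu>"
  shows "(\<integral>\<^sup>+y. ennreal (rl_kernel \<mu> (x - y) * rl_kernel \<nu> y) \<partial>lborel) = ennreal (rl_kernel (\<mu> + \<nu>) x)"
proof (cases "0 < x")
  case False
  then have zero: "rl_kernel \<mu> (x - y) * rl_kernel \<nu> y = 0" for y
    by (cases "0 < y") (auto simp: rl_kernel_def)
  show ?thesis
    unfolding zero using False by (simp add: rl_kernel_nonpos_arg)
next
  case True
  note G = Gamma_real_pos [OF assms(1)] Gamma_real_pos [OF assms(2)]
  have unit: "(\<integral>\<^sup>+z. ennreal (rl_kernel \<mu> (1 - z) * rl_kernel \<nu> z) \<partial>lborel) = ennreal (1 / Gamma (\<mu> + \<nu>))"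
  proof -
    have "((\<lambda>z. (z powr (\<nu> - 1) * (1 - z) powr (\<mu> - 1)) * (1 / (Gamma \<mu> * Gamma \<nu>)))
            has_integral (Beta \<nu> \<mu> * (1 / (Gamma \<mu> * Gamma \<nu>)))) {0<..<1}"
      using has_integral_Beta_real [OF assms(2,1)]
      by (intro has_integral_mult_left) (simp add: has_integral_Icc_iff_Ioo)
    then have "((\<lambda>z. rl_kernel \<mu> (1 - z) * rl_kernel \<nu> z)
            has_integral (Beta \<nu> \<mu> * (1 / (Gamma \<mu> * Gamma \<nu>)))) {0<..<1}"
      by (rule has_integral_eq [rotated]) (simp add: rl_kernel_def)
    then have "((\<lambda>z. rl_kernel \<mu> (1 - z) * rl_kernel \<nu> z)
            has_integral (Beta \<nu> \<mu> * (1 / (Gamma \<mu> * Gamma \<nu>)))) UNIV"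
      by (rule has_integral_on_superset) (auto simp: rl_kernel_def)
    then have "(\<integral>\<^sup>+z. ennreal (rl_kernel \<mu> (1 - z) * rl_kernel \<nu> z) \<partial>lborel)
        = ennreal (Beta \<nu> \<mu> * (1 / (Gamma \<mu> * Gamma \<nu>)))"
      using assms by (intro nn_integral_has_integral_lborel) (auto intro!: mult_nonneg_nonneg rl_kernel_nonneg)
    also have "Beta \<nu> \<mu> * (1 / (Gamma \<mu> * Gamma \<nu>)) = 1 / Gamma (\<mu> + \<nu>)"
      using G by (simp add: Beta_def add.commute field_simps)
    finally show ?thesis .
  qed
  have "(\<integral>\<^sup>+y. ennreal (rl_kernel \<mu> (x - y) * rl_kernel \<nu> y) \<partial>lborel)
      = ennreal x * (\<integral>\<^sup>+z. ennreal (rl_kernel \<mu> (x - (0 + x * z)) * rl_kernel \<nu> (0 + x * z)) \<partial>lborel)"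
    using True by (subst nn_integral_real_affine [where c = x and t = 0]) auto
  \<comment> \<open>The kernels contribute the exponent (\<mu> - 1) + (\<nu> - 1); the Jacobian x
    raises it to that of the kernel of order \<mu> + \<nu>.\<close>
  also have "\<dots> = ennreal x * (\<integral>\<^sup>+z. ennreal (x powr (\<mu> + \<nu> - 2)) * ennreal (rl_kernel \<mu> (1 - z) * rl_kernel \<nu> z) \<partial>lborel)"
  proof -
    have "rl_kernel \<mu> (x - x * z) * rl_kernel \<nu> (x * z)
        = x powr (\<mu> + \<nu> - 2) * (rl_kernel \<mu> (1 - z) * rl_kernel \<nu> z)" for z
    proof -
      have "x - x * z = x * (1 - z)" by (simp add: algebra_simps)
      moreover have "x powr (\<mu> + \<nu> - 2) = x powr (\<mu> - 1) * x powr (\<nu> - 1)"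
        by (simp flip: powr_add)
      ultimately show ?thesis
        using True by (simp only: rl_kernel_scale) simp
    qed
    then show ?thesis
      using assms by (simp add: ennreal_mult'[symmetric])
  qed
  also have "\<dots> = ennreal (rl_kernel (\<mu> + \<nu>) x)"
  proof -
    have "x * x powr (\<mu> + \<nu> - 2) = x powr (\<mu> + \<nu> - 1)"
      using True by (simp add: powr_mult_base)
    moreover have "(\<integral>\<^sup>+z. ennreal (x powr (\<mu> + \<nu> - 2)) * ennreal (rl_kernel \<mu> (1 - z) * rl_kernel \<nu> z) \<partial>lborel)
        = ennreal (x powr (\<mu> + \<nu> - 2)) * ennreal (1 / Gamma (\<mu> + \<nu>))"
      by (subst nn_integral_cmult) (auto simp: unit)
    ultimately show ?thesis
      using True assms Gamma_real_pos [of "\<mu> + \<nu>"]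
      by (simp add: rl_kernel_def flip: ennreal_mult ennreal_mult'')
  qed
  finally show ?thesis .
qed

lemma nn_integral_rl_kernel_convolution_shift:
  assumes "0 < \<mu>" "0 < \<nu>"
  shows "(\<integral>\<^sup>+y. ennreal (rl_kernel \<mu> (x - y) * rl_kernel \<nu> (y - z)) \<partial>lborel)
    = ennreal (rl_kernel (\<mu> + \<nu>) (x - z))"
proof -
  have "(\<integral>\<^sup>+y. ennreal (rl_kernel \<mu> (x - y) * rl_kernel \<nu> (y - z)) \<partial>lborel)
      = (\<integral>\<^sup>+y. ennreal (rl_kernel \<mu> (x - (z + 1 * y)) * rl_kernel \<nu> (z + 1 * y - z)) \<partial>lborel)"
    by (subst nn_integral_real_affine [where c = 1 and t = z]) auto
  then show ?thesis
    using nn_integral_rl_kernel_convolution [OF assms, of "x - z"] by (simp add: algebra_simps)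
qed

lemma has_bochner_integral_rl_kernel_convolution:
  assumes "0 < \<mu>" "0 < \<nu>"
  shows "has_bochner_integral lborel (\<lambda>y. rl_kernel \<mu> (x - y) * rl_kernel \<nu> (y - z))
    (rl_kernel (\<mu> + \<nu>) (x - z))"
  using assms
  by (intro has_bochner_integral_nn_integral)
     (auto simp: nn_integral_rl_kernel_convolution_shift
           intro!: AE_I2 mult_nonneg_nonneg rl_kernel_nonneg)

text \<open>The bound on \<open>k\<close> is the form in which membership in the weighted space gets
  used (\<open>lift_dominated\<close>); a convolution of two kernels then serves as
  majorant.\<close>

lemma integrable_rl_kernel_times:
  assumes "0 < \<mu>" "0 < \<gamma>" and [measurable]: "k \<in> borel_measurable borel"
    and k: "\<And>y. \<bar>k y\<bar> \<le> M * rl_kernel \<gamma> y"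
  shows "integrable lborel (\<lambda>y. rl_kernel \<mu> (x - y) * k y)"
proof (rule Bochner_Integration.integrable_bound)
  have "integrable lborel (\<lambda>y. rl_kernel \<mu> (x - y) * rl_kernel \<gamma> y)"
    using has_bochner_integral_rl_kernel_convolution [OF assms(1,2), of x 0]
    by (simp add: has_bochner_integral_iff)
  then show "integrable lborel (\<lambda>y. M * (rl_kernel \<mu> (x - y) * rl_kernel \<gamma> y))"
    by simp
  show "AE y in lborel. norm (rl_kernel \<mu> (x - y) * k y) \<le> norm (M * (rl_kernel \<mu> (x - y) * rl_kernel \<gamma> y))"
  proof (rule AE_I2)
    fix y
    have "\<bar>rl_kernel \<mu> (x - y)\<bar> * \<bar>k y\<bar> \<le> \<bar>rl_kernel \<mu> (x - y)\<bar> * \<bar>M * rl_kernel \<gamma> y\<bar>"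
      using k [of y] by (intro mult_left_mono) auto
    then show "norm (rl_kernel \<mu> (x - y) * k y) \<le> norm (M * (rl_kernel \<mu> (x - y) * rl_kernel \<gamma> y))"
      by (simp add: abs_mult mult_ac)
  qed
qed auto

text \<open>After exchanging the integrals, the inner one over y is a convolution of two kernels
  shifted by z. The same computation with absolute values justifies Fubini.\<close>

lemma rl_kernel_semigroup:
  assumes "0 < \<mu>" "0 < \<nu>" "0 < \<gamma>" and [measurable]: "k \<in> borel_measurable borel"
    and k: "\<And>y. \<bar>k y\<bar> \<le> M * rl_kernel \<gamma> y"
  shows "(\<integral>y. rl_kernel \<mu> (x - y) * (\<integral>z. rl_kernel \<nu> (y - z) * k z \<partial>lborel) \<partial>lborel)
    = (\<integral>z. rl_kernel (\<mu> + \<nu>) (x - z) * k z \<partial>lborel)"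
proof -
  let ?f = "\<lambda>z y. rl_kernel \<mu> (x - y) * rl_kernel \<nu> (y - z) * k z"
  note conv = has_bochner_integral_rl_kernel_convolution [OF assms(1,2), of x]
  have int: "integrable (lborel \<Otimes>\<^sub>M lborel) (\<lambda>(z, y). ?f z y)"
  proof (rule lborel_pair.Fubini_integrable)
    have "(\<integral>y. norm (?f z y) \<partial>lborel) = rl_kernel (\<mu> + \<nu>) (x - z) * \<bar>k z\<bar>" for z
      using conv [of z] assms(1,2)
      by (simp add: abs_mult rl_kernel_nonneg has_bochner_integral_integral_eq)
    moreover have "integrable lborel (\<lambda>z. rl_kernel (\<mu> + \<nu>) (x - z) * \<bar>k z\<bar>)"
      using assms by (intro integrable_rl_kernel_times [where M = M and \<gamma> = \<gamma>]) auto
    ultimately show "integrable lborel (\<lambda>z. \<integral>y. norm (case (z, y) of (z, y) \<Rightarrow> ?f z y) \<partial>lborel)"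
      by simp
    show "AE z in lborel. integrable lborel (\<lambda>y. case (z, y) of (z, y) \<Rightarrow> ?f z y)"
      using conv by (auto simp: has_bochner_integral_iff)
  qed auto
  have "(\<integral>y. rl_kernel \<mu> (x - y) * (\<integral>z. rl_kernel \<nu> (y - z) * k z \<partial>lborel) \<partial>lborel)
      = (\<integral>y. (\<integral>z. ?f z y \<partial>lborel) \<partial>lborel)"
    by (simp add: mult.assoc)
  also have "\<dots> = (\<integral>z. (\<integral>y. ?f z y \<partial>lborel) \<partial>lborel)"
    using lborel_pair.Fubini_integral [OF int] by simp
  also have "\<dots> = (\<integral>z. rl_kernel (\<mu> + \<nu>) (x - z) * k z \<partial>lborel)"
    using conv by (simp add: has_bochner_integral_iff)
  finally show ?thesis .
qed

text \<open>Substituting \<open>y = x * z\<close> moves \<open>x\<close> out of the singular kernel, so that dominated convergence applies.\<close>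

lemma rl_kernel_integral_representation:
  assumes "0 < \<mu>" "0 < \<gamma>" "continuous_on UNIV g" "\<And>y. \<bar>g y\<bar> \<le> M"
  obtains G where "continuous_on UNIV G"
    "\<And>x. 0 < x \<Longrightarrow> (\<integral>y. rl_kernel \<mu> (x - y) * (rl_kernel \<gamma> y * g y) \<partial>lborel) = x powr (\<mu> + \<gamma> - 1) * G x"
proof
  have [measurable]: "g \<in> borel_measurable borel"
    by (rule borel_measurable_continuous_onI [OF assms(3)])
  let ?w = "\<lambda>z. rl_kernel \<mu> (1 - z) * rl_kernel \<gamma> z"
  define G where "G x = (\<integral>z. ?w z * g (x * z) \<partial>lborel)" for x
  have w: "integrable lborel ?w"
    using assms by (intro integrable_rl_kernel_times [where M = 1 and \<gamma> = \<gamma>]) (auto simp: rl_kernel_nonneg)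
  show "continuous_on UNIV G"
    unfolding continuous_on_sequentially
  proof (intro allI ballI impI)
    fix X x assume X: "(\<forall>n::nat. X n \<in> UNIV) \<and> X \<longlonglongrightarrow> (x::real)"
    have "(\<lambda>n. \<integral>z. ?w z * g (X n * z) \<partial>lborel) \<longlonglongrightarrow> (\<integral>z. ?w z * g (x * z) \<partial>lborel)"
    proof (rule integral_dominated_convergence [where w = "\<lambda>z. ?w z * M"])
      show "integrable lborel (\<lambda>z. ?w z * M)" using w by simp
      show "AE z in lborel. (\<lambda>n. ?w z * g (X n * z)) \<longlonglongrightarrow> ?w z * g (x * z)"
        using X assms(3) by (intro AE_I2 tendsto_intros continuous_on_tendsto_compose [of UNIV g]) auto
      show "AE z in lborel. norm (?w z * g (X n * z)) \<le> ?w z * M" for n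
      proof (rule AE_I2)
        fix z
        have "?w z \<ge> 0" using assms by (auto intro!: mult_nonneg_nonneg rl_kernel_nonneg)
        then show "norm (?w z * g (X n * z)) \<le> ?w z * M"
          using assms(4) [of "X n * z"]
          by (metis abs_mult abs_of_nonneg mult_left_mono real_norm_def)
      qed
    qed auto
    then show "(G \<circ> X) \<longlonglongrightarrow> G x"
      by (simp add: G_def o_def)
  qed
  fix x :: real assume x: "0 < x"
  have "(\<integral>y. rl_kernel \<mu> (x - y) * (rl_kernel \<gamma> y * g y) \<partial>lborel)
      = x * (\<integral>z. rl_kernel \<mu> (x - x * z) * (rl_kernel \<gamma> (x * z) * g (x * z)) \<partial>lborel)"
    using x by (subst lborel_integral_real_affine [where c = x and t = 0]) auto
  also have "(\<lambda>z. rl_kernel \<mu> (x - x * z) * (rl_kernel \<gamma> (x * z) * g (x * z)))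
      = (\<lambda>z. x powr (\<mu> + \<gamma> - 2) * (?w z * g (x * z)))"
  proof
    fix z
    have "x - x * z = x * (1 - z)" by (simp add: algebra_simps)
    moreover have "x powr (\<mu> + \<gamma> - 2) = x powr (\<mu> - 1) * x powr (\<gamma> - 1)"
      by (simp flip: powr_add)
    ultimately show "rl_kernel \<mu> (x - x * z) * (rl_kernel \<gamma> (x * z) * g (x * z))
      = x powr (\<mu> + \<gamma> - 2) * (?w z * g (x * z))"
      using x by (simp only: rl_kernel_scale) simp
  qed
  also have "x * (\<integral>z. x powr (\<mu> + \<gamma> - 2) * (?w z * g (x * z)) \<partial>lborel)
     = (x * x powr (\<mu> + \<gamma> - 2)) * G x"
    by (simp add: G_def)
  also have "x * x powr (\<mu> + \<gamma> - 2) = x powr (\<mu> + \<gamma> - 1)"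
    using x by (simp add: powr_mult_base)
  finally show "(\<integral>y. rl_kernel \<mu> (x - y) * (rl_kernel \<gamma> y * g y) \<partial>lborel) = x powr (\<mu> + \<gamma> - 1) * G x" .
qed

section \<open>The substitution x = \<psi> t - \<psi> a\<close>

locale psi_scale =
  fixes a b :: real and \<psi> \<psi>' :: "real \<Rightarrow> real"
  assumes a_less_b: "a < b"
    and psi_deriv_within: "t \<in> {a..b} \<Longrightarrow> (\<psi> has_real_derivative \<psi>' t) (at t within {a..b})"
    and cont_psi': "continuous_on {a..b} \<psi>'"
    and mono_psi: "mono_on {a..b} \<psi>"
    and psi'_nonzero: "t \<in> {a..b} \<Longrightarrow> \<psi>' t \<noteq> 0"
begin

lemma cont_psi: "continuous_on {a..b} \<psi>"
  using psi_deriv_within by (meson DERIV_continuous_on)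

lemma psi_deriv_at: "t \<in> {a<..<b} \<Longrightarrow> (\<psi> has_real_derivative \<psi>' t) (at t)"
  using psi_deriv_within [of t] by (simp add: at_within_Icc_at)

text \<open>Monotonicity makes the derivative nonnegative and nonvanishing makes it positive. Strict
  monotonicity of \<psi>, hence invertibility of \<open>X\<close>, rests on this.\<close>

lemma psi'_pos:
  assumes "t \<in> {a<..<b}"
  shows "0 < \<psi>' t"
proof -
  have "0 \<le> \<psi>' t"
    by (rule mono_on_imp_deriv_nonneg [OF mono_psi psi_deriv_at]) (use assms in auto)
  with psi'_nonzero [of t] assms show ?thesis by simp
qed

lemma psi_less:
  assumes "a \<le> s" "s < t" "t \<le> b"
  shows "\<psi> s < \<psi> t"
proof (rule DERIV_pos_imp_increasing_open [OF assms(2)])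
  show "continuous_on {s..t} \<psi>"
    by (rule continuous_on_subset [OF cont_psi]) (use assms in auto)
  fix x assume "s < x" "x < t"
  with assms have "x \<in> {a<..<b}" by auto
  then show "\<exists>y. (\<psi> has_real_derivative y) (at x) \<and> 0 < y"
    using psi_deriv_at psi'_pos by blast
qed

definition X :: "real \<Rightarrow> real" where "X t = \<psi> t - \<psi> a"

lemma X_a [simp]: "X a = 0" by (simp add: X_def)

lemma X_less: "a \<le> s \<Longrightarrow> s < t \<Longrightarrow> t \<le> b \<Longrightarrow> X s < X t"
  using psi_less by (simp add: X_def)

lemma X_le: "a \<le> s \<Longrightarrow> s \<le> t \<Longrightarrow> t \<le> b \<Longrightarrow> X s \<le> X t"
  using X_less [of s t] by (cases "s = t") auto

lemma X_pos: "t \<in> {a<..b} \<Longrightarrow> 0 < X t"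
  using X_less [of a t] by simp

lemma X_nonneg: "t \<in> {a..b} \<Longrightarrow> 0 \<le> X t"
  using X_le [of a t] by simp

lemma inj_X: "inj_on X {a..b}"
  by (rule linorder_inj_onI) (use X_less in fastforce)+

lemma cont_X: "continuous_on {a..b} X"
  unfolding X_def by (intro continuous_intros cont_psi)

lemma X_image_Icc: "X ` {a..b} = {0..X b}"
proof
  show "X ` {a..b} \<subseteq> {0..X b}" using X_le [of _ b] X_nonneg by auto
  show "{0..X b} \<subseteq> X ` {a..b}"
  proof
    fix y assume "y \<in> {0..X b}"
    then show "y \<in> X ` {a..b}"
      using IVT' [of X a y b] a_less_b cont_X by force
  qed
qed

definition Xinv :: "real \<Rightarrow> real" where "Xinv = the_inv_into {a..b} X"

lemma Xinv_X: "t \<in> {a..b} \<Longrightarrow> Xinv (X t) = t"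
  unfolding Xinv_def by (rule the_inv_into_f_f [OF inj_X])

lemma cont_Xinv: "continuous_on {0..X b} Xinv"
  using continuous_on_inv_into [OF cont_X compact_Icc inj_X] by (simp add: X_image_Icc Xinv_def)

lemma X_Xinv: "y \<in> {0..X b} \<Longrightarrow> X (Xinv y) = y"
  unfolding Xinv_def by (rule f_the_inv_into_f [OF inj_X]) (simp add: X_image_Icc)

lemma Xinv_mem: "y \<in> {0..X b} \<Longrightarrow> Xinv y \<in> {a..b}"
  unfolding Xinv_def by (rule the_inv_into_into [OF inj_X]) (simp_all add: X_image_Icc)

lemma Xinv_mem': "y \<in> {0<..X b} \<Longrightarrow> Xinv y \<in> {a<..b}"
  using Xinv_mem [of y] X_Xinv [of y] by (cases "Xinv y = a") auto

lemma X_image_Ioo: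
  assumes "t \<in> {a<..b}"
  shows "X ` {a<..<t} = {0<..<X t}"
proof
  show "X ` {a<..<t} \<subseteq> {0<..<X t}" using X_less assms X_pos by auto
  show "{0<..<X t} \<subseteq> X ` {a<..<t}"
  proof
    fix y assume y: "y \<in> {0<..<X t}"
    with X_le [of t b] assms have y': "y \<in> {0<..X b}" by auto
    have "Xinv y < t"
    proof (rule ccontr)
      assume "\<not> Xinv y < t"
      then have "X t \<le> X (Xinv y)"
        using assms Xinv_mem' [OF y'] by (intro X_le) auto
      with y y' show False by (simp add: X_Xinv)
    qed
    with y' show "y \<in> X ` {a<..<t}"
      using Xinv_mem' [OF y'] X_Xinv [of y] by (auto intro!: image_eqI [of _ _ "Xinv y"])
  qed
qed

section \<open>The weighted space\<close>

abbreviation W :: "real \<Rightarrow> (real \<Rightarrow> real) set" where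
  "W \<gamma> \<equiv> psi_weighted_C a b \<psi> (1 - \<gamma>)"

abbreviation RL :: "real \<Rightarrow> (real \<Rightarrow> real) \<Rightarrow> real \<Rightarrow> real" where
  "RL \<equiv> psi_RL_integral a \<psi> \<psi>'"

text \<open>Together with \<open>W_E\<close> this recasts the space as products of a fixed power of
  \<open>X\<close> with functions continuous up to a; the two powers cancel because \<open>X\<close>
  is positive on (a,b].\<close>

lemma W_I:
  assumes "continuous_on {a..b} g" "\<And>t. t \<in> {a<..b} \<Longrightarrow> h t = X t powr (\<gamma> - 1) * g t"
  shows "h \<in> W \<gamma>"
  unfolding psi_weighted_C_def
proof (intro CollectI exI conjI ballI)
  fix t assume t: "t \<in> {a<..b}"
  then have "X t powr (1 - \<gamma>) * X t powr (\<gamma> - 1) = 1"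
    using X_pos [of t] by (simp flip: powr_add)
  then show "g t = (\<psi> t - \<psi> a) powr (1 - \<gamma>) * h t"
    using assms(2) [OF t] by (simp add: X_def flip: mult.assoc)
qed fact

lemma W_E:
  assumes "h \<in> W \<gamma>"
  obtains g where "continuous_on {a..b} g" "\<And>t. t \<in> {a<..b} \<Longrightarrow> h t = X t powr (\<gamma> - 1) * g t"
proof -
  from assms obtain g where g: "continuous_on {a..b} g" "\<And>t. t \<in> {a<..b} \<Longrightarrow> g t = X t powr (1 - \<gamma>) * h t"
    by (auto simp: psi_weighted_C_def X_def)
  have "h t = X t powr (\<gamma> - 1) * g t" if t: "t \<in> {a<..b}" for t
  proof -
    have "X t powr (\<gamma> - 1) * X t powr (1 - \<gamma>) = 1"
      using X_pos [OF t] by (simp flip: powr_add)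
    then show ?thesis using g(2) [OF t] by (simp flip: mult.assoc)
  qed
  with g(1) show ?thesis by (rule that)
qed

lemma W_cont:
  assumes "h \<in> W \<gamma>"
  shows "continuous_on {a<..b} h"
proof -
  obtain g where g: "continuous_on {a..b} g" "\<And>t. t \<in> {a<..b} \<Longrightarrow> h t = X t powr (\<gamma> - 1) * g t"
    using W_E [OF assms] by blast
  have "continuous_on {a<..b} (\<lambda>t. X t powr (\<gamma> - 1) * g t)"
    by (intro continuous_intros continuous_on_subset [OF cont_X] continuous_on_subset [OF g(1)])
       (use X_pos in force)+
  then show ?thesis by (rule continuous_on_eq) (simp add: g(2))
qed

lemma W_lincomb:
  assumes "h \<in> W \<gamma>" "k \<in> W \<gamma>"
  shows "(\<lambda>t. c * h t + d * k t) \<in> W \<gamma>"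
proof -
  obtain g where g: "continuous_on {a..b} g" "\<And>t. t \<in> {a<..b} \<Longrightarrow> h t = X t powr (\<gamma> - 1) * g t"
    using W_E [OF assms(1)] by blast
  obtain g' where g': "continuous_on {a..b} g'" "\<And>t. t \<in> {a<..b} \<Longrightarrow> k t = X t powr (\<gamma> - 1) * g' t"
    using W_E [OF assms(2)] by blast
  show ?thesis
    by (rule W_I [where g = "\<lambda>t. c * g t + d * g' t"])
       (auto intro!: continuous_intros g(1) g'(1) simp: g(2) g'(2) algebra_simps)
qed

lemma W_power: "(\<lambda>t. c * X t powr (\<gamma> - 1)) \<in> W \<gamma>"
  by (rule W_I [where g = "\<lambda>_. c"]) auto

section \<open>Fractional integrals as convolutions\<close>

definition lift :: "(real \<Rightarrow> real) \<Rightarrow> real \<Rightarrow> real" where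
  "lift h y = (if y \<in> {0<..X b} then h (Xinv y) else 0)"

lemma lift_X: "t \<in> {a<..b} \<Longrightarrow> lift h (X t) = h t"
  using X_pos [of t] X_le [of t b] by (simp add: lift_def Xinv_X)

text \<open>In the variable x the weight is the kernel of order \<gamma>, once
  \<open>Gamma \<gamma>\<close> is absorbed into the continuous factor.\<close>

lemma lift_repr:
  assumes "h \<in> W \<gamma>" "0 < \<gamma>"
  obtains g M where "continuous_on UNIV g" "\<And>y. \<bar>g y\<bar> \<le> M"
    "\<And>y. lift h y = indicator {0<..X b} y * (rl_kernel \<gamma> y * g y)"
proof -
  obtain g0 where g0: "continuous_on {a..b} g0" "\<And>t. t \<in> {a<..b} \<Longrightarrow> h t = X t powr (\<gamma> - 1) * g0 t"
    using W_E [OF assms(1)] by blast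
  define g1 where "g1 y = Gamma \<gamma> * g0 (Xinv y)" for y
  \<comment> \<open>Clamping the argument to [0, X b] extends \<open>g1\<close> to a bounded
    continuous function on the whole line.\<close>
  define g where "g y = g1 (max 0 (min (X b) y))" for y
  have Xb: "0 < X b" using X_pos a_less_b by simp
  have g1: "continuous_on {0..X b} g1"
    unfolding g1_def
    by (intro continuous_intros continuous_on_compose2 [OF g0(1) cont_Xinv]) (use Xinv_mem in auto)
  have "continuous_on UNIV g"
    unfolding g_def
    by (intro continuous_on_compose2 [OF g1] continuous_intros) (use Xb in auto)
  moreover obtain M where "\<And>y. y \<in> {0..X b} \<Longrightarrow> \<bar>g1 y\<bar> \<le> M"
    using compact_imp_bounded [OF compact_continuous_image [OF g1 compact_Icc]]
    by (fastforce simp: bounded_iff)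
  then have "\<bar>g y\<bar> \<le> M" for y
    unfolding g_def using Xb by auto
  moreover have "lift h y = indicator {0<..X b} y * (rl_kernel \<gamma> y * g y)" for y
  proof (cases "y \<in> {0<..X b}")
    case True
    then show ?thesis
      using Gamma_real_pos [OF assms(2)] Xinv_mem' [OF True]
      by (simp add: lift_def g0(2) X_Xinv rl_kernel_def g_def g1_def)
  qed (auto simp: lift_def)
  ultimately show ?thesis by (rule that)
qed

lemma lift_dominated:
  assumes "h \<in> W \<gamma>" "0 < \<gamma>"
  obtains M where "\<And>y. \<bar>lift h y\<bar> \<le> M * rl_kernel \<gamma> y"
proof -
  obtain g M where g: "continuous_on UNIV g" "\<And>y. \<bar>g y\<bar> \<le> M"
    "\<And>y. lift h y = indicator {0<..X b} y * (rl_kernel \<gamma> y * g y)"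
    using lift_repr [OF assms] by blast
  have "0 \<le> M" using g(2) [of 0] by linarith
  show ?thesis
  proof (rule that)
    fix y
    show "\<bar>lift h y\<bar> \<le> M * rl_kernel \<gamma> y"
      using g(2) [of y] rl_kernel_nonneg [OF assms(2), of y] \<open>0 \<le> M\<close>
      by (auto simp: g(3) abs_mult indicator_def mult.commute [of M] intro!: mult_left_mono)
  qed
qed

lemma lift_measurable:
  assumes "h \<in> W \<gamma>" "0 < \<gamma>"
  shows "lift h \<in> borel_measurable borel"
proof -
  obtain g M where g: "continuous_on UNIV g" "\<And>y. \<bar>g y\<bar> \<le> M"
    "\<And>y. lift h y = indicator {0<..X b} y * (rl_kernel \<gamma> y * g y)"
    using lift_repr [OF assms] by blast
  have [measurable]: "g \<in> borel_measurable borel"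
    by (rule borel_measurable_continuous_onI [OF g(1)])
  show ?thesis
    by (subst measurable_cong [OF g(3)]) measurable
qed

lemma integrable_kernel_lift:
  assumes "h \<in> W \<gamma>" "0 < \<gamma>" "0 < \<mu>"
  shows "integrable lborel (\<lambda>y. rl_kernel \<mu> (x - y) * lift h y)"
proof -
  obtain M where "\<And>y. \<bar>lift h y\<bar> \<le> M * rl_kernel \<gamma> y"
    using lift_dominated [OF assms(1,2)] by blast
  then show ?thesis
    using assms lift_measurable by (intro integrable_rl_kernel_times) auto
qed

text \<open>Substituting y = X s absorbs \<psi>' and turns \<psi> t - \<psi> s into X t - y. The
  kernel vanishes for y \<ge> X t and the lift for y \<le> 0, so the integral extends to the
  line.\<close>

lemma RL_change_of_variables:
  assumes h: "h \<in> W \<gamma>" "0 < \<gamma>" and \<mu>: "0 < \<mu>" and t: "t \<in> {a<..b}"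
  shows "RL \<mu> h t = (\<integral>y. rl_kernel \<mu> (X t - y) * lift h y \<partial>lborel)" (is ?eq)
    and "set_integrable lborel {a<..<t} (\<lambda>s. \<psi>' s * (\<psi> t - \<psi> s) powr (\<mu> - 1) * h s)" (is ?int)
proof -
  define f where "f y = Gamma \<mu> * (rl_kernel \<mu> (X t - y) * lift h y)" for y
  let ?S = "{a<..<t}" and ?F = "\<lambda>s. \<psi>' s * (\<psi> t - \<psi> s) powr (\<mu> - 1) * h s"
  have G: "0 < Gamma \<mu>" by (rule Gamma_real_pos [OF \<mu>])
  have f: "integrable lborel f"
    unfolding f_def using integrable_kernel_lift [OF h \<mu>] by simp
  have f_borel: "set_integrable lborel {0<..<X t} f"
    unfolding set_integrable_def by (intro integrable_mult_indicator f) simp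
  then have f_abs: "f absolutely_integrable_on {0<..<X t}"
    unfolding set_integrable_def
    by (subst integrable_completion) (auto dest: borel_measurable_integrable)
  have F: "\<bar>\<psi>' s\<bar> * f (X s) = ?F s" if "s \<in> ?S" for s
    using that t psi'_pos [of s] lift_X [of s h] X_less [of s t] G
    by (auto simp: f_def rl_kernel_def X_def)
  have deriv_X: "(X has_real_derivative \<psi>' s) (at s within ?S)" if "s \<in> ?S" for s
  proof -
    have "(\<psi> has_real_derivative \<psi>' s) (at s within ?S)"
      using psi_deriv_at [of s] that t by (auto intro: has_field_derivative_at_within)
    from DERIV_diff [OF this DERIV_const [of "\<psi> a"]] show ?thesis
      by (simp add: X_def [abs_def])
  qed
  have inj_S: "inj_on X ?S"
    by (rule inj_on_subset [OF inj_X]) (use t in auto)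
  have cov: "(\<lambda>s. \<bar>\<psi>' s\<bar> * f (X s)) absolutely_integrable_on ?S \<and>
      integral ?S (\<lambda>s. \<bar>\<psi>' s\<bar> * f (X s)) = integral {0<..<X t} f"
    using has_absolute_integral_change_of_variables_1' [OF _ deriv_X inj_S,
        of f "integral {0<..<X t} f"] f_abs X_image_Ioo [OF t]
    by simp
  then have F_abs: "?F absolutely_integrable_on ?S"
    using cov by (subst set_integrable_cong [OF refl refl F [symmetric]]) auto
  have int_F: "integral ?S ?F = integral {0<..<X t} f"
    using cov integral_cong [of ?S, OF F] by simp
  \<comment> \<open>The change of variables is stated for completed Lebesgue measure; continuity
    supplies the Borel measurability needed to return to \<open>lborel\<close>.\<close>
  have "continuous_on ?S ?F"
  proof (intro continuous_intros)
    show "continuous_on ?S \<psi>'" "continuous_on ?S \<psi>"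
      by (rule continuous_on_subset [OF cont_psi'] continuous_on_subset [OF cont_psi]; use t in auto)+
    show "continuous_on ?S h"
      by (rule continuous_on_subset [OF W_cont [OF h(1)]]) (use t in auto)
    show "\<forall>s\<in>?S. \<psi> t - \<psi> s \<noteq> 0"
    proof
      fix s assume "s \<in> ?S"
      then show "\<psi> t - \<psi> s \<noteq> 0" using psi_less [of s t] t by auto
    qed
  qed
  then have "(\<lambda>s. indicator ?S s *\<^sub>R ?F s) \<in> borel_measurable lborel"
    using borel_measurable_continuous_on_indicator [of ?S ?F] by simp
  with F_abs show int: ?int
    unfolding set_integrable_def by (subst (asm) integrable_completion)
  have "(LBINT s=a..t. ?F s) = integral ?S ?F"
    using t set_borel_integral_eq_integral(2) [OF int] by (simp add: interval_lebesgue_integral_le_eq)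
  also have "\<dots> = (LBINT y:{0<..<X t}. f y)"
    using int_F set_borel_integral_eq_integral(2) [OF f_borel] by simp
  also have "\<dots> = (\<integral>y. f y \<partial>lborel)"
    unfolding set_lebesgue_integral_def
    by (rule Bochner_Integration.integral_cong)
       (auto simp: f_def lift_def indicator_def rl_kernel_def)
  finally show ?eq
    using \<mu> less_imp_neq [OF G] by (simp add: psi_RL_integral_def f_def)
qed

section \<open>Mapping properties, semigroup law and powers\<close>

lemma RL_0 [simp]: "RL 0 h = h"
  by (rule ext) (simp add: psi_RL_integral_def)

lemma RL_cong:
  assumes "\<And>s. s \<in> {a<..b} \<Longrightarrow> h s = k s" "t \<in> {a<..b}"
  shows "RL \<mu> h t = RL \<mu> k t"
proof -
  have "(LBINT s:{a<..<t}. \<psi>' s * (\<psi> t - \<psi> s) powr (\<mu> - 1) * h s)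
      = (LBINT s:{a<..<t}. \<psi>' s * (\<psi> t - \<psi> s) powr (\<mu> - 1) * k s)"
    by (rule set_lebesgue_integral_cong) (use assms in auto)
  with assms show ?thesis
    by (simp add: psi_RL_integral_def interval_lebesgue_integral_le_eq)
qed

text \<open>Integration of order \<mu> improves the behaviour at a by the factor X^\<mu>. Both
  stability of the space and the limit at a are read off from this.\<close>

lemma RL_representation:
  assumes "h \<in> W \<gamma>" "0 < \<gamma>" "0 < \<mu>"
  obtains G where "continuous_on UNIV G"
    "\<And>t. t \<in> {a<..b} \<Longrightarrow> RL \<mu> h t = X t powr (\<mu> + \<gamma> - 1) * G (X t)"
proof -
  obtain g M where g: "continuous_on UNIV g" "\<And>y. \<bar>g y\<bar> \<le> M"
    "\<And>y. lift h y = indicator {0<..X b} y * (rl_kernel \<gamma> y * g y)"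
    using lift_repr [OF assms(1,2)] by blast
  obtain G where G: "continuous_on UNIV G"
    "\<And>x. 0 < x \<Longrightarrow> (\<integral>y. rl_kernel \<mu> (x - y) * (rl_kernel \<gamma> y * g y) \<partial>lborel) = x powr (\<mu> + \<gamma> - 1) * G x"
    using rl_kernel_integral_representation [OF assms(3,2) g(1,2)] by blast
  have "RL \<mu> h t = X t powr (\<mu> + \<gamma> - 1) * G (X t)" if t: "t \<in> {a<..b}" for t
  proof -
    have "rl_kernel \<mu> (X t - y) * lift h y = rl_kernel \<mu> (X t - y) * (rl_kernel \<gamma> y * g y)" for y
      using X_le [of t b] t
      by (cases "0 < y"; cases "y \<le> X b") (auto simp: g(3) rl_kernel_nonpos_arg)
    with RL_change_of_variables(1) [OF assms t] G(2) [OF X_pos [OF t]] show ?thesis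
      by simp
  qed
  with G(1) show ?thesis by (rule that)
qed

lemma RL_W:
  assumes "h \<in> W \<gamma>" "0 < \<gamma>" "0 \<le> \<mu>"
  shows "RL \<mu> h \<in> W \<gamma>"
proof (cases "\<mu> = 0")
  case False
  with assms have \<mu>: "0 < \<mu>" by simp
  obtain G where G: "continuous_on UNIV G"
    "\<And>t. t \<in> {a<..b} \<Longrightarrow> RL \<mu> h t = X t powr (\<mu> + \<gamma> - 1) * G (X t)"
    using RL_representation [OF assms(1,2) \<mu>] by blast
  show ?thesis
  proof (rule W_I)
    show "continuous_on {a..b} (\<lambda>t. X t powr \<mu> * G (X t))"
      using \<mu> X_nonneg
      by (intro continuous_on_mult continuous_on_powr' continuous_on_const cont_X
          continuous_on_compose2 [OF G(1) cont_X]) auto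
    show "RL \<mu> h t = X t powr (\<gamma> - 1) * (X t powr \<mu> * G (X t))" if "t \<in> {a<..b}" for t
      using that by (simp add: G(2) algebra_simps powr_add powr_diff)
  qed
qed (use assms in simp)

text \<open>The total exponent \<mu> + \<gamma> - 1 is positive, so the power of \<open>X\<close>
  tends to 0 at a while \<open>G\<close> stays bounded near 0.\<close>

lemma RL_tendsto_0:
  assumes "h \<in> W \<gamma>" "0 < \<gamma>" "0 < \<mu>" "1 - \<gamma> < \<mu>"
  shows "(RL \<mu> h \<longlongrightarrow> 0) (at_right a)"
proof -
  obtain G where G: "continuous_on UNIV G"
    "\<And>t. t \<in> {a<..b} \<Longrightarrow> RL \<mu> h t = X t powr (\<mu> + \<gamma> - 1) * G (X t)"
    using RL_representation [OF assms(1-3)] by blast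
  have "continuous_on {a..b} (\<lambda>t. X t powr (\<mu> + \<gamma> - 1) * G (X t))"
    using assms X_nonneg
    by (intro continuous_on_mult continuous_on_powr' continuous_on_const cont_X
        continuous_on_compose2 [OF G(1) cont_X]) auto
  then have "((\<lambda>t. X t powr (\<mu> + \<gamma> - 1) * G (X t)) \<longlongrightarrow> X a powr (\<mu> + \<gamma> - 1) * G (X a)) (at a within {a..b})"
    by (rule continuous_on_def [THEN iffD1, THEN bspec]) (use a_less_b in auto)
  then have "((\<lambda>t. X t powr (\<mu> + \<gamma> - 1) * G (X t)) \<longlongrightarrow> 0) (at_right a)"
    using a_less_b by (simp add: at_within_Icc_at_right)
  moreover have "\<forall>\<^sub>F t in at_right a. X t powr (\<mu> + \<gamma> - 1) * G (X t) = RL \<mu> h t"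
    unfolding eventually_at_right_field using a_less_b G(2) by (intro exI [of _ b]) auto
  ultimately show ?thesis by (rule Lim_transform_eventually)
qed

lemma RL_semigroup:
  assumes h: "h \<in> W \<gamma>" "0 < \<gamma>" and "0 \<le> \<mu>" "0 \<le> \<nu>" and t: "t \<in> {a<..b}"
  shows "RL \<mu> (RL \<nu> h) t = RL (\<mu> + \<nu>) h t"
proof (cases "\<mu> = 0 \<or> \<nu> = 0")
  case False
  with assms have pos: "0 < \<mu>" "0 < \<nu>" by auto
  obtain M where M: "\<And>y. \<bar>lift h y\<bar> \<le> M * rl_kernel \<gamma> y"
    using lift_dominated [OF h] by blast
  \<comment> \<open>Beyond X b the lift is 0 while the inner convolution need not be; the equation
    survives because the outer kernel vanishes there.\<close>
  have eq: "rl_kernel \<mu> (X t - y) * lift (RL \<nu> h) y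
      = rl_kernel \<mu> (X t - y) * (\<integral>z. rl_kernel \<nu> (y - z) * lift h z \<partial>lborel)" for y
  proof -
    consider "y \<le> 0" | "y \<in> {0<..X b}" | "X b < y" by fastforce
    then show ?thesis
    proof cases
      case 1
      then have zero: "rl_kernel \<nu> (y - z) * lift h z = 0" for z
        by (cases "0 < z") (auto simp: rl_kernel_nonpos_arg lift_def)
      show ?thesis unfolding zero using 1 by (simp add: lift_def)
    next
      case 2
      then show ?thesis
        using RL_change_of_variables(1) [OF h pos(2) Xinv_mem' [OF 2]] X_Xinv [of y]
        by (simp add: lift_def [of "RL \<nu> h"])
    next
      case 3
      then show ?thesis
        using X_le [of t b] t by (simp add: rl_kernel_nonpos_arg)
    qed
  qed
  have "RL \<nu> h \<in> W \<gamma>"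
    using h pos by (intro RL_W) auto
  then have "RL \<mu> (RL \<nu> h) t
      = (\<integral>y. rl_kernel \<mu> (X t - y) * (\<integral>z. rl_kernel \<nu> (y - z) * lift h z \<partial>lborel) \<partial>lborel)"
    by (simp only: RL_change_of_variables(1) [OF _ h(2) pos(1) t] eq)
  also have "\<dots> = RL (\<mu> + \<nu>) h t"
    using rl_kernel_semigroup [OF pos h(2) lift_measurable [OF h] M]
      RL_change_of_variables(1) [OF h _ t, of "\<mu> + \<nu>"] pos by simp
  finally show ?thesis .
qed auto

lemma RL_lincomb:
  assumes "h \<in> W \<gamma>" "k \<in> W \<gamma>" "0 < \<gamma>" "0 \<le> \<mu>" and t: "t \<in> {a<..b}"
  shows "RL \<mu> (\<lambda>s. c * h s + d * k s) t = c * RL \<mu> h t + d * RL \<mu> k t"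
proof (cases "\<mu> = 0")
  case False
  with assms have \<mu>: "0 < \<mu>" by simp
  have "rl_kernel \<mu> (X t - y) * lift (\<lambda>s. c * h s + d * k s) y
      = c * (rl_kernel \<mu> (X t - y) * lift h y) + d * (rl_kernel \<mu> (X t - y) * lift k y)" for y
    by (simp add: lift_def algebra_simps)
  then show ?thesis
    using RL_change_of_variables(1) [OF _ assms(3) \<mu> t] assms(1,2) W_lincomb [OF assms(1,2)]
      integrable_kernel_lift [OF assms(1,3) \<mu>, of "X t"] integrable_kernel_lift [OF assms(2,3) \<mu>, of "X t"]
    by simp
qed simp

text \<open>Up to the factor c the integrand is itself a kernel in the variable x, so convolution
  adds the orders. For \<mu> = 1 - \<gamma> the result is the constant c.\<close>

lemma RL_power:
  assumes "0 < \<gamma>" "0 \<le> \<mu>" and t: "t \<in> {a<..b}"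
  shows "RL \<mu> (\<lambda>s. c / Gamma \<gamma> * X s powr (\<gamma> - 1)) t = c / Gamma (\<mu> + \<gamma>) * X t powr (\<mu> + \<gamma> - 1)"
proof (cases "\<mu> = 0")
  case False
  with assms have \<mu>: "0 < \<mu>" by simp
  have eq: "rl_kernel \<mu> (X t - y) * lift (\<lambda>s. c / Gamma \<gamma> * X s powr (\<gamma> - 1)) y
      = c * (rl_kernel \<mu> (X t - y) * rl_kernel \<gamma> (y - 0))" for y
  proof -
    consider "y \<le> 0" | "y \<in> {0<..X b}" | "X b < y" by fastforce
    then show ?thesis
    proof cases
      case 2
      then show ?thesis using X_Xinv [of y] by (simp add: lift_def rl_kernel_def)
    next
      case 3
      then show ?thesis using X_le [of t b] t by (simp add: rl_kernel_nonpos_arg)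
    qed (simp add: lift_def rl_kernel_nonpos_arg)
  qed
  have "RL \<mu> (\<lambda>s. c / Gamma \<gamma> * X s powr (\<gamma> - 1)) t
      = (\<integral>y. c * (rl_kernel \<mu> (X t - y) * rl_kernel \<gamma> (y - 0)) \<partial>lborel)"
    unfolding RL_change_of_variables(1) [OF W_power assms(1) \<mu> t] eq ..
  also have "\<dots> = c * rl_kernel (\<mu> + \<gamma>) (X t - 0)"
    using has_bochner_integral_rl_kernel_convolution [OF \<mu> assms(1), of "X t" 0]
    by (simp only: integral_mult_right_zero has_bochner_integral_iff)
  finally show ?thesis
    using X_pos [OF t] by (simp add: rl_kernel_def)
qed simp

section \<open>Integration of order one: injectivity and the fundamental theorem\<close>

lemma RL_1:
  assumes "h \<in> W \<gamma>" "0 < \<gamma>" and t: "t \<in> {a<..b}"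
  shows "RL 1 h t = (LBINT s=a..t. \<psi>' s * h s)"
    and "set_integrable lborel {a<..<t} (\<lambda>s. \<psi>' s * h s)"
proof -
  \<comment> \<open>Since \<open>0 powr 0\<close> is 0, the power equals 1 only because the base is
    nonzero on the open interval.\<close>
  have eq: "\<psi>' s * (\<psi> t - \<psi> s) powr (1 - 1) * h s = \<psi>' s * h s" if "s \<in> {a<..<t}" for s
    using that t psi_less [of s t] by simp
  show "set_integrable lborel {a<..<t} (\<lambda>s. \<psi>' s * h s)"
    using RL_change_of_variables(2) [OF assms(1,2) zero_less_one t]
    by (subst set_integrable_cong [OF refl refl eq [symmetric]])
  have "(LBINT s:{a<..<t}. \<psi>' s * (\<psi> t - \<psi> s) powr (1 - 1) * h s) = (LBINT s:{a<..<t}. \<psi>' s * h s)"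
    by (rule set_lebesgue_integral_cong) (use eq in auto)
  with t show "RL 1 h t = (LBINT s=a..t. \<psi>' s * h s)"
    by (simp add: psi_RL_integral_def interval_lebesgue_integral_le_eq)
qed

lemma cont_integrand: "h \<in> W \<gamma> \<Longrightarrow> continuous_on {a<..b} (\<lambda>s. \<psi>' s * h s)"
  by (intro continuous_intros W_cont continuous_on_subset [OF cont_psi']) auto

lemma RL_1_eq_0D:
  assumes h: "h \<in> W \<gamma>" "0 < \<gamma>" and zero: "\<And>t. t \<in> {a<..b} \<Longrightarrow> RL 1 h t = 0" and t: "t \<in> {a<..b}"
  shows "h t = 0"
proof -
  \<comment> \<open>An interior base point keeps the integrand continuous on [c,t]; at a it may be
    singular. The integral from c vanishes as a difference of two integrals from a.\<close>
  define c where "c = (a + t) / 2"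
  let ?f = "\<lambda>s. \<psi>' s * h s"
  have c: "a < c" "c < t" "t \<le> b" using t by (auto simp: c_def)
  have "(LBINT s=c..x. ?f s) = 0" if x: "x \<in> {c..t}" for x
  proof -
    have x': "x \<in> {a<..b}" "c \<in> {a<..b}" using x c by auto
    have "interval_lebesgue_integrable lborel a x ?f"
      using RL_1(2) [OF h x'(1)] x' by (simp add: interval_lebesgue_integrable_def)
    then have "interval_lebesgue_integrable lborel (min (ereal a) (min (ereal c) (ereal x)))
        (max (ereal a) (max (ereal c) (ereal x))) ?f"
      using c x by (simp add: min_def max_def)
    from interval_integral_sum [OF this] show ?thesis
      using zero [OF x'(1)] zero [OF x'(2)] RL_1(1) [OF h x'(1)] RL_1(1) [OF h x'(2)] by simp
  qed
  moreover have "((\<lambda>x. LBINT s=c..x. ?f s) has_vector_derivative ?f t) (at t within {c..t})"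
    using c by (intro interval_integral_FTC2 continuous_on_subset [OF cont_integrand [OF h(1)]]) auto
  ultimately have "((\<lambda>x. 0) has_vector_derivative ?f t) (at t within {c..t})"
    using c by (auto intro: has_vector_derivative_transform [rotated 2])
  then have "?f t = 0"
    using c vector_derivative_unique_within [of t "{c..t}" "\<lambda>x. 0::real" "?f t" 0]
    by (simp add: at_within_Icc_at_left)
  with psi'_nonzero [of t] t show ?thesis by simp
qed

text \<open>Integrating once more, to order 1 - \<mu>, raises both sides to order one, where
  injectivity is known.\<close>

lemma RL_cancel:
  assumes h: "h \<in> W \<gamma>" and k: "k \<in> W \<gamma>" and \<gamma>: "0 < \<gamma>" and \<mu>: "0 \<le> \<mu>" "\<mu> \<le> 1"
    and eq: "\<And>t. t \<in> {a<..b} \<Longrightarrow> RL \<mu> h t = RL \<mu> k t" and t: "t \<in> {a<..b}"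
  shows "h t = k t"
proof -
  \<comment> \<open>The difference is written in the literal shape of \<open>W_lincomb\<close> and
    \<open>RL_lincomb\<close>.\<close>
  let ?d = "\<lambda>t. 1 * h t + (- 1) * k t"
  have "RL 1 ?d s = 0" if s: "s \<in> {a<..b}" for s
  proof -
    have "RL 1 h s = RL (1 - \<mu>) (RL \<mu> h) s"
      using RL_semigroup [OF h \<gamma> _ \<mu>(1) s, of "1 - \<mu>"] \<mu> by simp
    also have "\<dots> = RL (1 - \<mu>) (RL \<mu> k) s"
      using eq s by (rule RL_cong)
    also have "\<dots> = RL 1 k s"
      using RL_semigroup [OF k \<gamma> _ \<mu>(1) s, of "1 - \<mu>"] \<mu> by simp
    finally show ?thesis
      using RL_lincomb [OF h k \<gamma> zero_le_one s, of 1 "-1"] by simp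
  qed
  from RL_1_eq_0D [OF W_lincomb [OF h k] \<gamma> this t] show ?thesis by simp
qed

text \<open>The value of \<open>F\<close> at a has no meaning, so the fundamental theorem is used in
  the form where endpoint values are one-sided limits.\<close>

lemma RL_1_FTC:
  assumes w: "w \<in> W \<gamma>" "0 < \<gamma>"
    and F: "\<And>t. t \<in> {a<..b} \<Longrightarrow> (F has_vector_derivative \<psi>' t * w t) (at t within {a<..b})"
    and lim: "(F \<longlongrightarrow> c) (at_right a)" and t: "t \<in> {a<..b}"
  shows "F t = c + RL 1 w t"
proof -
  have "(LBINT s=a..t. \<psi>' s * w s) = F t - c"
  proof (rule interval_integral_FTC_integrable)
    fix x assume "ereal a < ereal x" "ereal x < ereal t"
    then have x: "x \<in> {a<..<t}" "x \<in> {a<..<b}" using t by auto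
    then have "(F has_vector_derivative \<psi>' x * w x) (at x within {a<..<b})"
      using F [of x] by (auto intro: has_vector_derivative_within_subset)
    then show "(F has_vector_derivative \<psi>' x * w x) (at x)"
      using at_within_open [OF x(2)] by simp
    have "continuous_on {a<..<b} (\<lambda>s. \<psi>' s * w s)"
      by (rule continuous_on_subset [OF cont_integrand [OF w(1)]]) auto
    then show "isCont (\<lambda>s. \<psi>' s * w s) x"
      using x by (simp add: continuous_on_eq_continuous_at)
  next
    \<comment> \<open>This gives the left limit at t even for t = b, where the derivative is only
      one-sided.\<close>
    have "(F \<longlongrightarrow> F t) (at t within {a<..b})"
      using F [OF t] has_vector_derivative_continuous continuous_within by blast
    then have "(F \<longlongrightarrow> F t) (at t within {(a + t) / 2..t})"
      by (rule tendsto_within_subset) (use t in auto)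
    then have "(F \<longlongrightarrow> F t) (at_left t)"
      using t by (simp add: at_within_Icc_at_left)
    then show "((F \<circ> real_of_ereal) \<longlongrightarrow> F t) (at_left (ereal t))"
      by (simp add: ereal_tendsto_simps)
  qed (use t lim RL_1(2) [OF w t] in \<open>auto simp: ereal_tendsto_simps\<close>)
  with RL_1(1) [OF w t] show ?thesis by simp
qed

end

section \<open>Equivalence of the Cauchy problem and the Volterra equation\<close>

theorem lemma9:
  fixes a b \<alpha> \<beta> \<gamma> u\<^sub>a :: real
    and \<psi> \<psi>' u :: "real \<Rightarrow> real"
    and f :: "real \<Rightarrow> real \<Rightarrow> real \<Rightarrow> real"
  assumes "0 < a" and "a < b"
    and "0 < \<alpha>" and "\<alpha> < 1" and "0 \<le> \<beta>" and "\<beta> \<le> 1"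
    and "\<gamma> = \<alpha> + \<beta> - \<alpha> * \<beta>"
    and "\<And>t. t \<in> {a..b} \<Longrightarrow> (\<psi> has_real_derivative \<psi>' t) (at t within {a..b})"
    and "continuous_on {a..b} \<psi>'"
    and "mono_on {a..b} \<psi>"
    and "\<And>t. t \<in> {a..b} \<Longrightarrow> \<psi>' t \<noteq> 0"
    and "\<And>v w. v \<in> psi_weighted_C a b \<psi> (1 - \<gamma>) \<Longrightarrow> w \<in> psi_weighted_C a b \<psi> (1 - \<gamma>) \<Longrightarrow>
           (\<lambda>t. f t (v t) (w t)) \<in> psi_weighted_C a b \<psi> (1 - \<gamma>)"
    and "u \<in> psi_weighted_C_deriv a b \<psi> \<psi>' \<gamma>"
  shows "((\<forall>t\<in>{a<..b}. psi_Hilfer_deriv a b \<psi> \<psi>' \<alpha> \<beta> u t =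
                         f t (u t) (psi_Hilfer_deriv a b \<psi> \<psi>' \<alpha> \<beta> u t)) \<and>
          (psi_RL_integral a \<psi> \<psi>' (1 - \<gamma>) u \<longlongrightarrow> u\<^sub>a) (at_right a))
     \<longleftrightarrow> (\<forall>t\<in>{a<..b}.
            u t = u\<^sub>a / Gamma \<gamma> * (\<psi> t - \<psi> a) powr (\<gamma> - 1) +
                  1 / Gamma \<alpha> * (LBINT s=a..t. \<psi>' s * (\<psi> t - \<psi> s) powr (\<alpha> - 1) *
                                   f s (u s) (psi_Hilfer_deriv a b \<psi> \<psi>' \<alpha> \<beta> u s)))"
proof -
  interpret psi_scale a b \<psi> \<psi>'
    by unfold_locales (use assms in auto)
  \<comment> \<open>The first bound gives \<alpha> \<le> \<gamma>, the second \<gamma> = \<beta> +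
    \<alpha> * (1 - \<beta>) \<le> 1.\<close>
  have "\<alpha> * \<beta> \<le> \<beta>" "\<alpha> * (1 - \<beta>) \<le> 1 - \<beta>"
    using assms(3-6) by (auto intro: mult_left_le_one_le)
  then have \<gamma>: "0 < \<gamma>" "\<gamma> \<le> 1" "\<alpha> \<le> \<gamma>"
    using assms(3,7) by (auto simp: algebra_simps)
  have exps: "(1 - \<beta>) * (1 - \<alpha>) = 1 - \<gamma>" "\<beta> * (1 - \<alpha>) = \<gamma> - \<alpha>"
    using assms(7) by (simp_all add: algebra_simps)
  define w where "w = psi_RL_deriv a b \<psi> \<psi>' \<gamma> u"
  define D where "D = psi_Hilfer_deriv a b \<psi> \<psi>' \<alpha> \<beta> u"
  define g where "g t = f t (u t) (D t)" for t
  define F where "F = RL (1 - \<gamma>) u"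
  have D: "D = RL (\<gamma> - \<alpha>) w"
    by (simp add: D_def w_def psi_Hilfer_deriv_def psi_RL_deriv_def exps)
  have u: "u \<in> W \<gamma>" and w: "w \<in> W \<gamma>" and F_diff: "F differentiable_on {a<..b}"
    using assms(13) by (auto simp: psi_weighted_C_deriv_def w_def F_def)
  \<comment> \<open>The hypothesis on \<open>f\<close> applies only to arguments in the space, so
    \<open>D\<close> has to be placed there before \<open>g\<close>.\<close>
  have D_W: "D \<in> W \<gamma>"
    unfolding D using w \<gamma> by (intro RL_W) auto
  have g: "g \<in> W \<gamma>"
    using assms(12) [OF u D_W] by (simp add: g_def [abs_def])
  \<comment> \<open>Differentiability of \<open>F\<close> makes the total
    \<open>vector_derivative\<close> inside \<open>w\<close> a genuine derivative.\<close>
  have F_deriv: "(F has_vector_derivative \<psi>' t * w t) (at t within {a<..b})" if "t \<in> {a<..b}" for t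
    using that F_diff psi'_nonzero [of t]
    by (simp add: w_def psi_RL_deriv_def psi_deriv_def differentiable_on_def vector_derivative_works F_def)
  have F_eq: "F t = u\<^sub>a + RL 1 w t" if "(F \<longlongrightarrow> u\<^sub>a) (at_right a)" "t \<in> {a<..b}" for t
    using RL_1_FTC [OF w \<gamma>(1) F_deriv that] .
  \<comment> \<open>The added power is the function whose integral of order 1 - \<gamma> is the
    constant \<open>u\<^sub>a\<close>.\<close>
  define p where "p h t = u\<^sub>a / Gamma \<gamma> * X t powr (\<gamma> - 1) + h t" for h t
  have p_W: "p h \<in> W \<gamma>" if "h \<in> W \<gamma>" for h
    using W_lincomb [OF W_power that, of 1 "u\<^sub>a / Gamma \<gamma>" 1] by (simp add: p_def [abs_def])
  have RL_p: "RL (1 - \<gamma>) (p h) t = u\<^sub>a + RL (1 - \<gamma>) h t" if "h \<in> W \<gamma>" "t \<in> {a<..b}" for h t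
    using RL_lincomb [OF W_power that(1) \<gamma>(1) _ that(2), of "1 - \<gamma>" 1 "u\<^sub>a / Gamma \<gamma>" 1]
      RL_power [OF \<gamma>(1) _ that(2), of "1 - \<gamma>" "u\<^sub>a"] X_pos [OF that(2)] \<gamma>
    by (simp add: p_def [abs_def])
  have "(\<forall>t\<in>{a<..b}. D t = g t) \<and> (F \<longlongrightarrow> u\<^sub>a) (at_right a) \<longleftrightarrow> (\<forall>t\<in>{a<..b}. u t = p (RL \<alpha> g) t)"
  proof (intro iffI conjI ballI; (elim conjE)?)
    fix t assume Dg: "\<forall>t\<in>{a<..b}. D t = g t" and lim: "(F \<longlongrightarrow> u\<^sub>a) (at_right a)" and t: "t \<in> {a<..b}"
    have w': "RL \<gamma> w \<in> W \<gamma>" using RL_W [OF w \<gamma>(1)] \<gamma> by simp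
    \<comment> \<open>Both sides have the same integral of order 1 - \<gamma>, namely
      \<open>u\<^sub>a + RL 1 w\<close>.\<close>
    have "u t = p (RL \<gamma> w) t"
    proof (rule RL_cancel [OF u p_W [OF w'] \<gamma>(1), of "1 - \<gamma>"])
      fix s assume s: "s \<in> {a<..b}"
      have "RL (1 - \<gamma>) (p (RL \<gamma> w)) s = u\<^sub>a + RL 1 w s"
        using RL_p [OF w' s] RL_semigroup [OF w \<gamma>(1) _ _ s, of "1 - \<gamma>" \<gamma>] \<gamma> by simp
      with F_eq [OF lim s] show "RL (1 - \<gamma>) u s = RL (1 - \<gamma>) (p (RL \<gamma> w)) s"
        by (simp add: F_def)
    qed (use \<gamma> t in auto)
    also have "RL \<gamma> w t = RL \<alpha> D t"
      using RL_semigroup [OF w \<gamma>(1) _ _ t, of \<alpha> "\<gamma> - \<alpha>"] \<gamma> assms(3) by (simp add: D)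
    then have "p (RL \<gamma> w) t = p (RL \<alpha> g) t"
      using RL_cong [of D g t \<alpha>] Dg t by (simp add: p_def)
    finally show "u t = p (RL \<alpha> g) t" .
  next
    assume volterra: "\<forall>t\<in>{a<..b}. u t = p (RL \<alpha> g) t"
    have g': "RL \<alpha> g \<in> W \<gamma>" using RL_W [OF g \<gamma>(1)] assms(3) by simp
    have F_g: "F t = u\<^sub>a + RL (1 - \<gamma> + \<alpha>) g t" if t: "t \<in> {a<..b}" for t
    proof -
      have "F t = RL (1 - \<gamma>) (p (RL \<alpha> g)) t"
        unfolding F_def using volterra t by (intro RL_cong) auto
      then show ?thesis
        using RL_p [OF g' t] RL_semigroup [OF g \<gamma>(1) _ _ t, of "1 - \<gamma>" \<alpha>] \<gamma> assms(3) by simp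
    qed
    \<comment> \<open>The order exceeds 1 - \<gamma> because \<alpha> is positive, so the integral
      vanishes at a and the initial condition follows.\<close>
    have "((\<lambda>t. u\<^sub>a + RL (1 - \<gamma> + \<alpha>) g t) \<longlongrightarrow> u\<^sub>a + 0) (at_right a)"
      using \<gamma> assms(3) by (intro tendsto_add tendsto_const RL_tendsto_0 [OF g]) auto
    moreover have "\<forall>\<^sub>F t in at_right a. u\<^sub>a + RL (1 - \<gamma> + \<alpha>) g t = F t"
      unfolding eventually_at_right_field using a_less_b F_g by (intro exI [of _ b]) auto
    ultimately show lim: "(F \<longlongrightarrow> u\<^sub>a) (at_right a)"
      using Lim_transform_eventually by fastforce
    fix t assume t: "t \<in> {a<..b}"
    show "D t = g t"
    \<comment> \<open>Adding 1 - \<gamma> + \<alpha> to the order \<gamma> - \<alpha> of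
      \<open>D\<close> over \<open>w\<close> gives order one. With the initial condition just shown,
      both integrals equal \<open>F\<close> minus \<open>u\<^sub>a\<close>.\<close>
    proof (rule RL_cancel [OF D_W g \<gamma>(1), of "1 - \<gamma> + \<alpha>"])
      fix s assume s: "s \<in> {a<..b}"
      have "RL (1 - \<gamma> + \<alpha>) D s = RL 1 w s"
        using RL_semigroup [OF w \<gamma>(1) _ _ s, of "1 - \<gamma> + \<alpha>" "\<gamma> - \<alpha>"] \<gamma> assms(3) by (simp add: D)
      with F_eq [OF lim s] F_g [OF s] show "RL (1 - \<gamma> + \<alpha>) D s = RL (1 - \<gamma> + \<alpha>) g s"
        by simp
    qed (use \<gamma> assms(3) t in auto)
  qed
  \<comment> \<open>Positivity of \<alpha> selects the integral branch of
    \<open>psi_RL_integral\<close>.\<close>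
  then show ?thesis
    using assms(3) by (simp add: p_def g_def D_def F_def X_def psi_RL_integral_def [of a \<psi> \<psi>' \<alpha>])
qed

end
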